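(* Let $\Theta$ be a locally compact Hausdorff space countable at infinity, let $X$ be a (complex) Banach space, let $\varphi=\{\varphi_t\}_{t\in\mathbb{R}}$ be a continuous flow on $\Theta$, let $\Phi=\{\Phi_t(\theta)\}_{t\ge 0,\theta\in\Theta}$ be a strongly continuous exponentially bounded cocycle over $\varphi$ acting on $\Theta\times X$, and let $C=\{C_t(\theta)\}_{t\ge0,\theta\in\Theta}$ be a scalar cocycle over the same flow $\varphi$ acting on $\Theta\times\mathbb{C}$. Let $C\Phi=\{C_t(\theta)\Phi_t(\theta)\}_{t\ge0,\theta\in\Theta}$ be the product cocycle on $\Theta\times X$. Then $$\Sigma_{C\Phi}\subset\Sigma_C+\Sigma_\Phi,$$ where the right-hand side is the arithmetic sum $\{\lambda+\mu:\lambda\in\Sigma_C,\ \mu\in\Sigma_\Phi\}$.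
   Context: "Countable at infinity" means $\sigma$-compact. $\mathcal{L}(X)$ denotes the bounded linear operators on $X$. Cocycle: a strongly continuous exponentially bounded cocycle $\Phi$ over the flow $\varphi$ acting on $\Theta\times X$ is a family $\{\Phi_t(\theta)\}_{t\ge0,\theta\in\Theta}\subset\mathcal{L}(X)$, strongly continuous in $(t,\theta)$ (i.e. $(t,\theta)\mapsto\Phi_t(\theta)x$ is continuous for each $x\in X$), with $\Phi_0(\theta)=I$, $\Phi_t(\varphi_s(\theta))\Phi_s(\theta)=\Phi_{t+s}(\theta)$ for all $\theta\in\Theta$, $t,s\ge0$, and $\sup_{0\le t\le1,\,\theta\in\Theta}\|\Phi_t(\theta)\|<\infty$. A scalar cocycle is such a cocycle with $X$ replaced by $\mathbb{C}$. Exponential dichotomy: $\Phi$ has exponential dichotomy if there exist a projector-valued mapping $\theta\mapsto P(\theta)\in\mathcal{L}(X)$, continuous in the strong operator topology, and constants $\varepsilon>0$, $M>0$ such that (1) $\Phi_t(\theta)P(\theta)=P(\varphi_t(\theta))\Phi_t(\theta)$ for all $t\ge0$, $\theta\in\Theta$; (2) $\sup_{\theta\in\Theta}\|\Phi_t(\theta)|_{\mathrm{Im}\,P(\theta)}\|\le Me^{-\varepsilon t}$ for all $t\ge0$; (3) the restriction $\Phi_t(\theta)|_{\mathrm{Ker}\,P(\theta)}:\mathrm{Ker}\,P(\theta)\to\mathrm{Ker}\,P(\varphi_t(\theta))$ is invertible, and $\|\Phi_t(\theta)x\|\ge M^{-1}e^{\varepsilon t}\|x\|$ for all $x\in\mathrm{Ker}\,P(\theta)$,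 $t\ge0$, $\theta\in\Theta$. Dynamical spectrum: $\Sigma_\Phi$ is the set of all $\lambda\in\mathbb{R}$ such that the cocycle $\{e^{-\lambda t}\Phi_t(\theta)\}$ has no exponential dichotomy; $\Sigma_C$ and $\Sigma_{C\Phi}$ are defined in the same way for the cocycles $C$ and $C\Phi$. *)

theory Defs
  imports "HOL-Analysis.Analysis"
begin

section \<open>Complex Banach spaces\<close>

text \<open>
  HOL-Analysis only has real Banach spaces. A complex Banach space is a real one with a complex
  scalar multiplication that extends the real one and for which the norm is homogeneous.
\<close>

class complex_banach = banach +
  fixes scaleC :: "complex \<Rightarrow> 'a \<Rightarrow> 'a"  (infixr \<open>*\<^sub>C\<close> 75)
  assumes scaleC_add_right: "a *\<^sub>C (x + y) = a *\<^sub>C x + a *\<^sub>C y"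
    and scaleC_add_left: "(a + b) *\<^sub>C x = a *\<^sub>C x + b *\<^sub>C x"
    and scaleC_scaleC: "a *\<^sub>C b *\<^sub>C x = (a * b) *\<^sub>C x"
    and scaleC_of_real: "complex_of_real r *\<^sub>C x = r *\<^sub>R x"
    and norm_scaleC: "norm (a *\<^sub>C x) = cmod a * norm x"

instantiation complex :: complex_banach
begin

definition scaleC_complex :: "complex \<Rightarrow> complex \<Rightarrow> complex"
  where "scaleC_complex a x = a * x"

instance
  by standard (auto simp: scaleC_complex_def distrib_left distrib_right mult.assoc norm_mult
      scaleR_conv_of_real)

end

text \<open>
  The complex algebra \<open>\<L>(X)\<close> is the set of those elements of the real algebra
  \<^typ>\<open>'x \<Rightarrow>\<^sub>L 'x\<close> that are complex-linear; the operator norms agree.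
\<close>

definition clinear_op :: "('x::complex_banach \<Rightarrow>\<^sub>L 'x) \<Rightarrow> bool"
  where "clinear_op A \<longleftrightarrow> (\<forall>c x. blinfun_apply A (c *\<^sub>C x) = c *\<^sub>C blinfun_apply A x)"

lemma bounded_linear_scaleC: "bounded_linear (\<lambda>x::'x::complex_banach. c *\<^sub>C x)"
proof (rule bounded_linear_intro)
  show "c *\<^sub>C (x + y) = c *\<^sub>C x + c *\<^sub>C y" for x y :: 'x
    by (rule scaleC_add_right)
  show "c *\<^sub>C r *\<^sub>R x = r *\<^sub>R c *\<^sub>C x" for r and x :: 'x
    by (metis scaleC_scaleC scaleC_of_real mult.commute)
  show "norm (c *\<^sub>C x) \<le> norm x * cmod c" for x :: 'x
    by (simp add: norm_scaleC)
qed

lift_definition scalar_op :: "complex \<Rightarrow> ('x::complex_banach \<Rightarrow>\<^sub>L 'x)" is "\<lambda>c x. c *\<^sub>C x"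
  by (rule bounded_linear_scaleC)

lemma clinear_op_scalar_op: "clinear_op (scalar_op c)"
  unfolding clinear_op_def scalar_op.rep_eq by (metis scaleC_scaleC mult.commute)


section \<open>Flows and cocycles\<close>

definition sigma_compact_space :: "'a topology \<Rightarrow> bool"
  where "sigma_compact_space T \<longleftrightarrow>
    (\<exists>K :: nat \<Rightarrow> 'a set. (\<forall>n. compactin T (K n)) \<and> topspace T = (\<Union>n. K n))"

definition continuous_flow :: "(real \<Rightarrow> 'th::topological_space \<Rightarrow> 'th) \<Rightarrow> bool"
  where "continuous_flow \<phi> \<longleftrightarrow>
    continuous_on UNIV (\<lambda>(t, \<theta>). \<phi> t \<theta>) \<and>
    (\<forall>\<theta>. \<phi> 0 \<theta> = \<theta>) \<and>
    (\<forall>t s \<theta>. \<phi> t (\<phi> s \<theta>) = \<phi> (t + s) \<theta>)"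

text \<open>A family indexed by \<open>t \<ge> 0\<close> is a function on \<^typ>\<open>real\<close> whose values at \<open>t < 0\<close> are irrelevant.\<close>

definition cocycle ::
    "(real \<Rightarrow> 'th::topological_space \<Rightarrow> 'th) \<Rightarrow> (real \<Rightarrow> 'th \<Rightarrow> ('x::complex_banach \<Rightarrow>\<^sub>L 'x)) \<Rightarrow> bool"
  where "cocycle \<phi> \<Phi> \<longleftrightarrow>
    (\<forall>t\<ge>0. \<forall>\<theta>. clinear_op (\<Phi> t \<theta>)) \<and>
    (\<forall>x. continuous_on ({0..} \<times> UNIV) (\<lambda>(t, \<theta>). blinfun_apply (\<Phi> t \<theta>) x)) \<and>
    (\<forall>\<theta>. \<Phi> 0 \<theta> = id_blinfun) \<and>
    (\<forall>t\<ge>0. \<forall>s\<ge>0. \<forall>\<theta>. \<Phi> t (\<phi> s \<theta>) o\<^sub>L \<Phi> s \<theta> = \<Phi> (t + s) \<theta>) \<and>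
    bdd_above {norm (\<Phi> t \<theta>) | t \<theta>. 0 \<le> t \<and> t \<le> 1}"

text \<open>
  Scalar cocycles are complex-valued functions; a number \<open>c\<close> is identified with the operator of
  multiplication by \<open>c\<close>, which gives every element of \<open>\<L>(\<complex>)\<close> exactly once.
\<close>

definition scalar_cocycle_op ::
    "(real \<Rightarrow> 'th \<Rightarrow> complex) \<Rightarrow> real \<Rightarrow> 'th \<Rightarrow> (complex \<Rightarrow>\<^sub>L complex)"
  where "scalar_cocycle_op C = (\<lambda>t \<theta>. scalar_op (C t \<theta>))"

definition product_cocycle ::
    "(real \<Rightarrow> 'th \<Rightarrow> complex) \<Rightarrow> (real \<Rightarrow> 'th \<Rightarrow> ('x::complex_banach \<Rightarrow>\<^sub>L 'x)) \<Rightarrow>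
     real \<Rightarrow> 'th \<Rightarrow> ('x \<Rightarrow>\<^sub>L 'x)"
  where "product_cocycle C \<Phi> = (\<lambda>t \<theta>. scalar_op (C t \<theta>) o\<^sub>L \<Phi> t \<theta>)"


section \<open>Exponential dichotomy and dynamical spectrum\<close>

text \<open>
  The uniform bound on the norm of the restriction of \<open>\<Phi> t \<theta>\<close> to \<open>Im P(\<theta>)\<close> is stated pointwise,
  since a supremum of reals is only meaningful once boundedness is known. Invertibility of the
  restriction to the kernels is bijectivity; the lower estimate makes the inverse bounded.
\<close>

definition exponential_dichotomy ::
    "(real \<Rightarrow> 'th::topological_space \<Rightarrow> 'th) \<Rightarrow> (real \<Rightarrow> 'th \<Rightarrow> ('x::complex_banach \<Rightarrow>\<^sub>L 'x)) \<Rightarrow> bool"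
  where "exponential_dichotomy \<phi> \<Phi> \<longleftrightarrow>
    (\<exists>(P :: 'th \<Rightarrow> ('x \<Rightarrow>\<^sub>L 'x)) \<epsilon> M. \<epsilon> > 0 \<and> M > 0 \<and>
      (\<forall>\<theta>. clinear_op (P \<theta>) \<and> P \<theta> o\<^sub>L P \<theta> = P \<theta>) \<and>
      (\<forall>x. continuous_on UNIV (\<lambda>\<theta>. blinfun_apply (P \<theta>) x)) \<and>
      (\<forall>t\<ge>0. \<forall>\<theta>. \<Phi> t \<theta> o\<^sub>L P \<theta> = P (\<phi> t \<theta>) o\<^sub>L \<Phi> t \<theta>) \<and>
      (\<forall>t\<ge>0. \<forall>\<theta>. \<forall>x \<in> range (blinfun_apply (P \<theta>)).
         norm (blinfun_apply (\<Phi> t \<theta>) x) \<le> M * exp (- \<epsilon> * t) * norm x) \<and>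
      (\<forall>t\<ge>0. \<forall>\<theta>. bij_betw (blinfun_apply (\<Phi> t \<theta>))
         {x. blinfun_apply (P \<theta>) x = 0} {x. blinfun_apply (P (\<phi> t \<theta>)) x = 0}) \<and>
      (\<forall>t\<ge>0. \<forall>\<theta>. \<forall>x \<in> {x. blinfun_apply (P \<theta>) x = 0}.
         norm (blinfun_apply (\<Phi> t \<theta>) x) \<ge> inverse M * exp (\<epsilon> * t) * norm x))"

definition dynamical_spectrum ::
    "(real \<Rightarrow> 'th::topological_space \<Rightarrow> 'th) \<Rightarrow> (real \<Rightarrow> 'th \<Rightarrow> ('x::complex_banach \<Rightarrow>\<^sub>L 'x)) \<Rightarrow> real set"
  where "dynamical_spectrum \<phi> \<Phi> =
    {\<mu>. \<not> exponential_dichotomy \<phi> (\<lambda>t \<theta>. exp (- \<mu> * t) *\<^sub>R \<Phi> t \<theta>)}"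

end

theory Submission
  imports Defs
begin

text \<open>
  Suppose \<open>l\<close> is not a sum of points of the two spectra. Then for every real \<open>\<mu>\<close> the scalar cocycle has a
  dichotomy at rate \<open>\<mu>\<close>, or \<open>\<Phi>\<close> has one at rate \<open>l - \<mu>\<close>. A dichotomy of a scalar cocycle has only \<open>0\<close>
  and \<open>1\<close> as projections, so it cuts the base into two invariant clopen sets: on one \<open>|C|\<close> grows
  slower than \<open>exp (\<mu> * t)\<close>, on the other faster (\<open>scalar_dichotomy_split\<close>).

  The argument lets \<open>\<mu>\<close> run through the real line from left to right and collects an invariant clopen
  set \<open>U\<close> over which \<open>C \<Phi>\<close> already has a dichotomy at rate \<open>l\<close>. What is known over the rest depends
  on which of the two cocycles has the dichotomy: either \<open>|C|\<close> grows at least like \<open>exp (\<mu> * t)\<close> there,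
  or \<open>C \<Phi>\<close> expands there, faster than \<open>exp (l * t)\<close>, on the kernels of the projections of \<open>\<Phi>\<close> at rate
  \<open>l - \<mu>\<close>. These are the predicates \<open>scalar_expanding_remainder\<close> and \<open>kernel_expanding_remainder\<close>.

  Where both cocycles have dichotomies, each predicate implies the other. The first gives the second
  because the growth rates multiply. For the second to give the first, \<open>U\<close> must absorb the part of the
  rest where \<open>|C|\<close> is slower than \<open>exp (\<mu> * t)\<close>; there the projections of \<open>\<Phi>\<close> give a dichotomy of
  \<open>C \<Phi>\<close>: the product contracts their ranges since both factors are slow, and it expands their kernels
  by assumption. Along the set of rates at which the respective cocycle has a dichotomy, each
  predicate is locally constant. For the first this holds because the rest must avoid the slow part.
  For the second it holds because the kernels of a dichotomy are unique
  (\<open>dichotomy_kernels_subset\<close>), hence do not depend on the rate locally.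

  So the applicable predicate holds at one rate if and only if it holds at any other, the line being
  connected. At very negative \<open>\<mu>\<close> the projections of \<open>\<Phi>\<close> are the identity, their kernels are zero, and
  the second predicate holds with empty \<open>U\<close>. At very large \<open>\<mu>\<close> the first predicate therefore holds,
  and since \<open>C\<close> is exponentially bounded, nothing can be left outside \<open>U\<close>: the product has a dichotomy
  at rate \<open>l\<close> over the whole base.
\<close>

section \<open>Dichotomies at a given rate over a subset of the base\<close>

text \<open>
  The two exponents replace the rescaling of the cocycle in the definition of the spectrum, so that
  different rates can be compared for one and the same cocycle. The conditions at a single point
  \<open>\<theta>\<close> mention \<open>P\<close> only along the forward orbit of \<open>\<theta>\<close>; this is what makes them local with respect to
  invariant subsets.
\<close>

definition splits_at ::
    "(real \<Rightarrow> 'th \<Rightarrow> 'th) \<Rightarrow> (real \<Rightarrow> 'th \<Rightarrow> ('x::complex_banach \<Rightarrow>\<^sub>L 'x)) \<Rightarrow>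
     ('th \<Rightarrow> ('x \<Rightarrow>\<^sub>L 'x)) \<Rightarrow> real \<Rightarrow> real \<Rightarrow> real \<Rightarrow> 'th \<Rightarrow> bool"
  where "splits_at \<phi> \<Psi> P a b M \<theta> \<longleftrightarrow>
    clinear_op (P \<theta>) \<and> P \<theta> o\<^sub>L P \<theta> = P \<theta> \<and>
    (\<forall>t\<ge>0. \<Psi> t \<theta> o\<^sub>L P \<theta> = P (\<phi> t \<theta>) o\<^sub>L \<Psi> t \<theta> \<and>
      bij_betw (blinfun_apply (\<Psi> t \<theta>)) {x. blinfun_apply (P \<theta>) x = 0}
        {x. blinfun_apply (P (\<phi> t \<theta>)) x = 0} \<and>
      (\<forall>x. blinfun_apply (P \<theta>) x = x \<longrightarrow> norm (blinfun_apply (\<Psi> t \<theta>) x) \<le> M * exp (a * t) * norm x) \<and>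
      (\<forall>x. blinfun_apply (P \<theta>) x = 0 \<longrightarrow> exp (b * t) * norm x \<le> M * norm (blinfun_apply (\<Psi> t \<theta>) x)))"

definition dichotomy_on ::
    "(real \<Rightarrow> 'th::topological_space \<Rightarrow> 'th) \<Rightarrow> (real \<Rightarrow> 'th \<Rightarrow> ('x::complex_banach \<Rightarrow>\<^sub>L 'x)) \<Rightarrow>
     real \<Rightarrow> 'th set \<Rightarrow> ('th \<Rightarrow> ('x \<Rightarrow>\<^sub>L 'x)) \<Rightarrow> bool"
  where "dichotomy_on \<phi> \<Psi> \<mu> S P \<longleftrightarrow>
    (\<forall>x. continuous_on S (\<lambda>\<theta>. blinfun_apply (P \<theta>) x)) \<and>
    (\<exists>\<epsilon>>0. \<exists>M>0. \<forall>\<theta>\<in>S. splits_at \<phi> \<Psi> P (\<mu> - \<epsilon>) (\<mu> + \<epsilon>) M \<theta>)"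

definition invariant_clopen :: "(real \<Rightarrow> 'th::topological_space \<Rightarrow> 'th) \<Rightarrow> 'th set \<Rightarrow> bool"
  where "invariant_clopen \<phi> U \<longleftrightarrow> closed U \<and> closed (- U) \<and> (\<forall>t\<ge>0. \<forall>\<theta>. \<phi> t \<theta> \<in> U \<longleftrightarrow> \<theta> \<in> U)"

lemma blinfun_eq_iff: "A = B \<longleftrightarrow> (\<forall>x. blinfun_apply A x = blinfun_apply B x)"
  by (auto intro: blinfun_eqI)

lemma splits_atD:
  assumes "splits_at \<phi> \<Psi> P a b M \<theta>"
  shows "blinfun_apply (P \<theta>) (c *\<^sub>C x) = c *\<^sub>C blinfun_apply (P \<theta>) x"
    and "blinfun_apply (P \<theta>) (blinfun_apply (P \<theta>) x) = blinfun_apply (P \<theta>) x"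
    and "t \<ge> 0 \<Longrightarrow> blinfun_apply (\<Psi> t \<theta>) (blinfun_apply (P \<theta>) x)
      = blinfun_apply (P (\<phi> t \<theta>)) (blinfun_apply (\<Psi> t \<theta>) x)"
    and "t \<ge> 0 \<Longrightarrow> bij_betw (blinfun_apply (\<Psi> t \<theta>)) {x. blinfun_apply (P \<theta>) x = 0}
      {x. blinfun_apply (P (\<phi> t \<theta>)) x = 0}"
    and "t \<ge> 0 \<Longrightarrow> blinfun_apply (P \<theta>) x = x \<Longrightarrow>
      norm (blinfun_apply (\<Psi> t \<theta>) x) \<le> M * exp (a * t) * norm x"
    and "t \<ge> 0 \<Longrightarrow> blinfun_apply (P \<theta>) x = 0 \<Longrightarrow>
      exp (b * t) * norm x \<le> M * norm (blinfun_apply (\<Psi> t \<theta>) x)"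
  using assms unfolding splits_at_def clinear_op_def blinfun_eq_iff blinfun_apply_blinfun_compose by blast+

lemma splits_at_mono:
  assumes "splits_at \<phi> \<Psi> P a b M \<theta>" "a \<le> a'" "b' \<le> b" "M \<le> M'" "0 < M"
  shows "splits_at \<phi> \<Psi> P a' b' M' \<theta>"
proof -
  have "norm (\<Psi> t \<theta> x) \<le> M' * exp (a' * t) * norm x" if "t \<ge> 0" "P \<theta> x = x" for t x
  proof -
    have "norm (\<Psi> t \<theta> x) \<le> M * exp (a * t) * norm x"
      using assms(1) that by (auto simp: splits_at_def)
    also have "\<dots> \<le> M' * exp (a' * t) * norm x"
      using assms that by (intro mult_mono) (auto intro: mult_right_mono)
    finally show ?thesis .
  qed
  moreover have "exp (b' * t) * norm x \<le> M' * norm (\<Psi> t \<theta> x)" if "t \<ge> 0" "P \<theta> x = 0" for t x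
  proof -
    have "exp (b' * t) * norm x \<le> exp (b * t) * norm x"
      using assms that by (intro mult_mono) (auto intro: mult_right_mono)
    also have "\<dots> \<le> M * norm (\<Psi> t \<theta> x)"
      using assms(1) that by (auto simp: splits_at_def)
    also have "\<dots> \<le> M' * norm (\<Psi> t \<theta> x)"
      using assms by (intro mult_mono) auto
    finally show ?thesis .
  qed
  ultimately show ?thesis
    using assms(1) by (auto simp: splits_at_def)
qed

lemma bij_betw_scaled:
  fixes A :: "'x::complex_banach \<Rightarrow>\<^sub>L 'x"
  assumes "r \<noteq> 0"
  shows "bij_betw (blinfun_apply (r *\<^sub>R A)) {x. blinfun_apply P x = 0} {x. blinfun_apply Q x = 0}
    \<longleftrightarrow> bij_betw (blinfun_apply A) {x. blinfun_apply P x = 0} {x. blinfun_apply Q x = 0}"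
proof -
  have *: "bij_betw (blinfun_apply (s *\<^sub>R B)) {x. blinfun_apply P x = 0} {x. blinfun_apply Q x = 0}"
    if "s \<noteq> 0" "bij_betw (blinfun_apply B) {x. blinfun_apply P x = 0} {x. blinfun_apply Q x = 0}"
    for s and B :: "'x \<Rightarrow>\<^sub>L 'x"
  proof -
    have "bij_betw (\<lambda>x. s *\<^sub>R x) {x. blinfun_apply Q x = 0} {x. blinfun_apply Q x = 0}"
      using that(1)
      by (intro bij_betw_byWitness[where f' = "\<lambda>x. inverse s *\<^sub>R x"]) (auto simp: blinfun.scaleR_right)
    from bij_betw_trans[OF that(2) this] show ?thesis
      by (simp add: o_def scaleR_blinfun.rep_eq)
  qed
  show ?thesis
    using *[of r A] *[of "inverse r" "r *\<^sub>R A"] assms by auto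
qed

text \<open>
  The factor \<open>exp (- \<mu> * t)\<close> is moved from the operators into the exponents; the range of a projection
  is its set of fixed points.
\<close>

lemma exponential_dichotomy_rescaled_iff:
  fixes \<Psi> :: "real \<Rightarrow> 'th::topological_space \<Rightarrow> ('x::complex_banach \<Rightarrow>\<^sub>L 'x)"
  shows "exponential_dichotomy \<phi> (\<lambda>t \<theta>. exp (- \<mu> * t) *\<^sub>R \<Psi> t \<theta>) \<longleftrightarrow>
    (\<exists>P. dichotomy_on \<phi> \<Psi> \<mu> UNIV P)"
proof -
  have range_iff: "x \<in> range (blinfun_apply Q) \<longleftrightarrow> blinfun_apply Q x = x"
    if "Q o\<^sub>L Q = Q" for Q :: "'x \<Rightarrow>\<^sub>L 'x" and x
  proof -
    have "blinfun_apply Q (blinfun_apply Q y) = blinfun_apply Q y" for y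
      by (metis that blinfun_apply_blinfun_compose)
    then show ?thesis by (metis rangeE rangeI)
  qed
  have up: "norm (blinfun_apply (exp (- \<mu> * t) *\<^sub>R A) x) \<le> M * exp (- \<epsilon> * t) * norm x \<longleftrightarrow>
      norm (blinfun_apply A x) \<le> M * exp ((\<mu> - \<epsilon>) * t) * norm x" for A :: "'x \<Rightarrow>\<^sub>L 'x" and t \<epsilon> M x
  proof -
    have "norm (blinfun_apply (exp (- \<mu> * t) *\<^sub>R A) x) = exp (- \<mu> * t) * norm (blinfun_apply A x)"
      by (simp add: scaleR_blinfun.rep_eq)
    moreover have "M * exp (- \<epsilon> * t) * norm x = exp (- \<mu> * t) * (M * exp ((\<mu> - \<epsilon>) * t) * norm x)"
      by (simp add: algebra_simps flip: exp_add)
    ultimately show ?thesis by (simp only: mult_le_cancel_left_pos exp_gt_zero)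
  qed
  have low: "norm (blinfun_apply (exp (- \<mu> * t) *\<^sub>R A) x) \<ge> inverse M * exp (\<epsilon> * t) * norm x \<longleftrightarrow>
      exp ((\<mu> + \<epsilon>) * t) * norm x \<le> M * norm (blinfun_apply A x)" 
    if "M > 0" for A :: "'x \<Rightarrow>\<^sub>L 'x" and t \<epsilon> M x
  proof -
    have "norm (blinfun_apply (exp (- \<mu> * t) *\<^sub>R A) x)
        = exp (- \<mu> * t) * inverse M * (M * norm (blinfun_apply A x))"
      using that by (simp add: scaleR_blinfun.rep_eq)
    moreover have "inverse M * exp (\<epsilon> * t) * norm x
        = exp (- \<mu> * t) * inverse M * (exp ((\<mu> + \<epsilon>) * t) * norm x)"
      by (simp add: algebra_simps flip: exp_add)
    ultimately show ?thesis
      using that by (simp only: mult_le_cancel_left_pos mult_pos_pos exp_gt_zero positive_imp_inverse_positive)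
  qed
  have comm: "(exp (- \<mu> * t) *\<^sub>R A) o\<^sub>L P = Q o\<^sub>L (exp (- \<mu> * t) *\<^sub>R A) \<longleftrightarrow> A o\<^sub>L P = Q o\<^sub>L A"
    for A P Q :: "'x \<Rightarrow>\<^sub>L 'x" and t
    by (simp add: blinfun_eq_iff scaleR_blinfun.rep_eq blinfun.scaleR_right)
  \<comment> \<open>the conditions are first listed one by one for all points; here they are collected at each point\<close>
  have regroup: "(e \<and> m \<and> (\<forall>\<theta>. A \<theta> \<and> B \<theta>) \<and> K \<and> (\<forall>t\<ge>0. \<forall>\<theta>. D t \<theta>) \<and>
      (\<forall>t\<ge>0. \<forall>\<theta>. \<forall>x. E t \<theta> x) \<and> (\<forall>t\<ge>0. \<forall>\<theta>. F t \<theta>) \<and> (\<forall>t\<ge>0. \<forall>\<theta>. \<forall>x. H t \<theta> x))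
    \<longleftrightarrow> e \<and> m \<and> K \<and> (\<forall>\<theta>. A \<theta> \<and> B \<theta> \<and> (\<forall>t\<ge>0. D t \<theta> \<and> F t \<theta> \<and> (\<forall>x. E t \<theta> x) \<and> (\<forall>x. H t \<theta> x)))"
    for e m K :: bool and A B :: "'th \<Rightarrow> bool" and D F :: "real \<Rightarrow> 'th \<Rightarrow> bool"
      and E H :: "real \<Rightarrow> 'th \<Rightarrow> 'x \<Rightarrow> bool"
    by blast
  have eq: "(\<epsilon> > 0 \<and> M > 0 \<and>
      (\<forall>\<theta>. clinear_op (P \<theta>) \<and> P \<theta> o\<^sub>L P \<theta> = P \<theta>) \<and>
      (\<forall>x. continuous_on UNIV (\<lambda>\<theta>. blinfun_apply (P \<theta>) x)) \<and>
      (\<forall>t\<ge>0. \<forall>\<theta>. (exp (- \<mu> * t) *\<^sub>R \<Psi> t \<theta>) o\<^sub>L P \<theta> = P (\<phi> t \<theta>) o\<^sub>L (exp (- \<mu> * t) *\<^sub>R \<Psi> t \<theta>)) \<and>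
      (\<forall>t\<ge>0. \<forall>\<theta>. \<forall>x \<in> range (blinfun_apply (P \<theta>)).
         norm (blinfun_apply (exp (- \<mu> * t) *\<^sub>R \<Psi> t \<theta>) x) \<le> M * exp (- \<epsilon> * t) * norm x) \<and>
      (\<forall>t\<ge>0. \<forall>\<theta>. bij_betw (blinfun_apply (exp (- \<mu> * t) *\<^sub>R \<Psi> t \<theta>))
         {x. blinfun_apply (P \<theta>) x = 0} {x. blinfun_apply (P (\<phi> t \<theta>)) x = 0}) \<and>
      (\<forall>t\<ge>0. \<forall>\<theta>. \<forall>x \<in> {x. blinfun_apply (P \<theta>) x = 0}.
         norm (blinfun_apply (exp (- \<mu> * t) *\<^sub>R \<Psi> t \<theta>) x) \<ge> inverse M * exp (\<epsilon> * t) * norm x))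
     \<longleftrightarrow> \<epsilon> > 0 \<and> M > 0 \<and> (\<forall>x. continuous_on UNIV (\<lambda>\<theta>. blinfun_apply (P \<theta>) x)) \<and>
      (\<forall>\<theta>. splits_at \<phi> \<Psi> P (\<mu> - \<epsilon>) (\<mu> + \<epsilon>) M \<theta>)" for P \<epsilon> M
  proof (cases "M > 0 \<and> (\<forall>\<theta>. P \<theta> o\<^sub>L P \<theta> = P \<theta>)")
    case True
    then have M: "M > 0" and ran: "x \<in> range (blinfun_apply (P \<theta>)) \<longleftrightarrow> blinfun_apply (P \<theta>) x = x" for x \<theta>
      using range_iff by auto
    show ?thesis
      unfolding splits_at_def up comm bij_betw_scaled[OF exp_not_eq_zero] low[OF M] Ball_def ran mem_Collect_eq
      by (rule regroup)
  qed (auto simp: splits_at_def)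
  show ?thesis
    unfolding exponential_dichotomy_def dichotomy_on_def eq by auto
qed

lemma not_in_dynamical_spectrum_iff:
  "\<mu> \<notin> dynamical_spectrum \<phi> \<Psi> \<longleftrightarrow> (\<exists>P. dichotomy_on \<phi> \<Psi> \<mu> UNIV P)"
  unfolding dynamical_spectrum_def mem_Collect_eq not_not
  by (rule exponential_dichotomy_rescaled_iff)

text \<open>
  The gap \<open>\<epsilon>\<close> in the growth rates leaves room to move \<open>\<mu>\<close> while keeping the same projections.
\<close>

lemma dichotomy_on_nearby:
  assumes "dichotomy_on \<phi> \<Psi> \<mu> S P"
  shows "\<exists>\<delta>>0. \<forall>\<mu>'. \<bar>\<mu>' - \<mu>\<bar> < \<delta> \<longrightarrow> dichotomy_on \<phi> \<Psi> \<mu>' S P"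
proof -
  obtain \<epsilon> M where *: "\<epsilon> > 0" "M > 0" "\<And>\<theta>. \<theta> \<in> S \<Longrightarrow> splits_at \<phi> \<Psi> P (\<mu> - \<epsilon>) (\<mu> + \<epsilon>) M \<theta>"
    using assms by (auto simp: dichotomy_on_def)
  have "dichotomy_on \<phi> \<Psi> \<mu>' S P" if "\<bar>\<mu>' - \<mu>\<bar> < \<epsilon>" for \<mu>'
  proof -
    have "\<forall>\<theta>\<in>S. splits_at \<phi> \<Psi> P (\<mu>' - (\<epsilon> - \<bar>\<mu>' - \<mu>\<bar>)) (\<mu>' + (\<epsilon> - \<bar>\<mu>' - \<mu>\<bar>)) M \<theta>"
      using * that by (auto intro!: splits_at_mono[OF *(3)])
    moreover have "\<epsilon> - \<bar>\<mu>' - \<mu>\<bar> > 0" using that by simp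
    ultimately show ?thesis
      using assms *(2) unfolding dichotomy_on_def by blast
  qed
  with *(1) show ?thesis by blast
qed

lemma dichotomy_on_union:
  assumes A: "dichotomy_on \<phi> \<Psi> \<mu> A P" "invariant_clopen \<phi> A"
    and B: "dichotomy_on \<phi> \<Psi> \<mu> B Q" "invariant_clopen \<phi> B" and disj: "A \<inter> B = {}"
  shows "dichotomy_on \<phi> \<Psi> \<mu> (A \<union> B) (\<lambda>\<theta>. if \<theta> \<in> A then P \<theta> else Q \<theta>)"
proof -
  let ?R = "\<lambda>\<theta>. if \<theta> \<in> A then P \<theta> else Q \<theta>"
  obtain \<epsilon>1 M1 where 1: "\<epsilon>1 > 0" "M1 > 0" "\<And>\<theta>. \<theta> \<in> A \<Longrightarrow> splits_at \<phi> \<Psi> P (\<mu> - \<epsilon>1) (\<mu> + \<epsilon>1) M1 \<theta>"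
    using A by (auto simp: dichotomy_on_def)
  obtain \<epsilon>2 M2 where 2: "\<epsilon>2 > 0" "M2 > 0" "\<And>\<theta>. \<theta> \<in> B \<Longrightarrow> splits_at \<phi> \<Psi> Q (\<mu> - \<epsilon>2) (\<mu> + \<epsilon>2) M2 \<theta>"
    using B by (auto simp: dichotomy_on_def)
  define \<epsilon> M where "\<epsilon> = min \<epsilon>1 \<epsilon>2" and "M = max M1 M2"
  have "splits_at \<phi> \<Psi> ?R (\<mu> - \<epsilon>) (\<mu> + \<epsilon>) M \<theta>" if "\<theta> \<in> A" for \<theta>
  proof -
    have "splits_at \<phi> \<Psi> P (\<mu> - \<epsilon>) (\<mu> + \<epsilon>) M \<theta>"
      by (rule splits_at_mono[OF 1(3)[OF that]]) (auto simp: \<epsilon>_def M_def 1)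
    then show ?thesis
      using that A(2) by (auto simp: splits_at_def invariant_clopen_def)
  qed
  moreover have "splits_at \<phi> \<Psi> ?R (\<mu> - \<epsilon>) (\<mu> + \<epsilon>) M \<theta>" if "\<theta> \<in> B" for \<theta>
  proof -
    have "splits_at \<phi> \<Psi> Q (\<mu> - \<epsilon>) (\<mu> + \<epsilon>) M \<theta>"
      by (rule splits_at_mono[OF 2(3)[OF that]]) (auto simp: \<epsilon>_def M_def 2)
    moreover have "\<theta> \<notin> A" "\<And>t. t \<ge> 0 \<Longrightarrow> \<phi> t \<theta> \<notin> A"
      using that disj A(2) by (auto simp: invariant_clopen_def)
    ultimately show ?thesis
      by (auto simp: splits_at_def)
  qed
  moreover have "continuous_on (A \<union> B) (\<lambda>\<theta>. blinfun_apply (?R \<theta>) x)" for x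
  proof -
    have "continuous_on (A \<union> B) (\<lambda>\<theta>. if \<theta> \<in> A then blinfun_apply (P \<theta>) x else blinfun_apply (Q \<theta>) x)"
      using assms by (intro continuous_on_cases) (auto simp: dichotomy_on_def invariant_clopen_def)
    also have "(\<lambda>\<theta>. if \<theta> \<in> A then blinfun_apply (P \<theta>) x else blinfun_apply (Q \<theta>) x)
      = (\<lambda>\<theta>. blinfun_apply (?R \<theta>) x)" by auto
    finally show ?thesis .
  qed
  moreover have "\<epsilon> > 0" "M > 0" using 1 2 by (auto simp: \<epsilon>_def M_def)
  ultimately show ?thesis
    unfolding dichotomy_on_def by blast
qed

section \<open>Growth bounds and uniqueness of the kernels\<close>

lemma cocycle_exponential_bound:
  assumes "cocycle \<phi> \<Phi>"
  obtains K \<omega> where "K > 0" "\<And>t \<theta>. t \<ge> 0 \<Longrightarrow> norm (\<Phi> t \<theta>) \<le> K * exp (\<omega> * t)"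
proof -
  have bdd: "bdd_above {norm (\<Phi> t \<theta>) | t \<theta>. 0 \<le> t \<and> t \<le> 1}"
    and coc: "\<And>t s \<theta>. t \<ge> 0 \<Longrightarrow> s \<ge> 0 \<Longrightarrow> \<Phi> t (\<phi> s \<theta>) o\<^sub>L \<Phi> s \<theta> = \<Phi> (t + s) \<theta>"
    using assms by (auto simp: cocycle_def)
  obtain K0 where K0: "\<And>t \<theta>. 0 \<le> t \<Longrightarrow> t \<le> 1 \<Longrightarrow> norm (\<Phi> t \<theta>) \<le> K0"
    using bdd unfolding bdd_above_def by blast
  define K where "K = max 1 K0"
  have K: "K \<ge> 1" "\<And>t \<theta>. 0 \<le> t \<Longrightarrow> t \<le> 1 \<Longrightarrow> norm (\<Phi> t \<theta>) \<le> K"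
    using K0 by (auto simp: K_def le_max_iff_disj)
  have step: "norm (\<Phi> t \<theta>) \<le> K ^ Suc n" if "real n \<le> t" "t \<le> real (Suc n)" for n t \<theta>
    using that
  proof (induction n arbitrary: t)
    case 0
    then show ?case using K by simp
  next
    case (Suc n)
    have "norm (\<Phi> t \<theta>) = norm (\<Phi> 1 (\<phi> (t - 1) \<theta>) o\<^sub>L \<Phi> (t - 1) \<theta>)"
      using coc[of 1 "t - 1" \<theta>] Suc.prems by simp
    also have "\<dots> \<le> norm (\<Phi> 1 (\<phi> (t - 1) \<theta>)) * norm (\<Phi> (t - 1) \<theta>)"
      by (rule norm_blinfun_compose)
    also have "\<dots> \<le> K * K ^ Suc n"
      using K Suc.IH[of "t - 1"] Suc.prems by (intro mult_mono) auto
    finally show ?case by simp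
  qed
  have "norm (\<Phi> t \<theta>) \<le> K * exp (ln K * t)" if "t \<ge> 0" for t \<theta>
  proof -
    define n where "n = nat \<lfloor>t\<rfloor>"
    have n: "real n \<le> t" "t \<le> real (Suc n)"
      using that by (auto simp: n_def) linarith
    have "norm (\<Phi> t \<theta>) \<le> K * K ^ n" using step[OF n] by simp
    also have "K ^ n = exp (ln K * real n)"
      using K(1) by (simp add: exp_of_nat2_mult)
    also have "K * exp (ln K * real n) \<le> K * exp (ln K * t)"
      using K(1) n(1) by (auto intro!: mult_left_mono)
    finally show ?thesis .
  qed
  moreover have "K > 0" using K by simp
  ultimately show ?thesis by (rule that[rotated])
qed

lemma dichotomy_on_above_growth:
  fixes \<Phi> :: "real \<Rightarrow> 'th::topological_space \<Rightarrow> ('x::complex_banach \<Rightarrow>\<^sub>L 'x)"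
  assumes "K > 0" "\<And>t \<theta>. t \<ge> 0 \<Longrightarrow> norm (\<Phi> t \<theta>) \<le> K * exp (\<omega> * t)" "\<omega> < \<mu>"
  shows "dichotomy_on \<phi> \<Phi> \<mu> UNIV (\<lambda>_. id_blinfun)"
proof -
  have "norm (\<Phi> t \<theta> x) \<le> K * exp (\<omega> * t) * norm x" if "t \<ge> 0" for t \<theta> x
    using norm_blinfun[of "\<Phi> t \<theta>" x] mult_right_mono[OF assms(2)[OF that, of \<theta>], of "norm x"]
    by simp
  then have "splits_at \<phi> \<Phi> (\<lambda>_. id_blinfun) (\<mu> - (\<mu> - \<omega>)) (\<mu> + (\<mu> - \<omega>)) K \<theta>" for \<theta>
    by (auto intro!: blinfun_eqI simp: splits_at_def clinear_op_def bij_betw_def inj_on_def blinfun.zero_right)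
  then show ?thesis
    using assms unfolding dichotomy_on_def
    by (intro conjI exI[of _ "\<mu> - \<omega>"] exI[of _ K]) auto
qed

lemma exp_eventually_large:
  fixes c \<epsilon> :: real
  assumes "\<epsilon> > 0"
  obtains t where "t \<ge> 0" "c < exp (\<epsilon> * t)"
proof
  define t where "t = max 0 c / \<epsilon>"
  show "t \<ge> 0" using assms by (simp add: t_def)
  have "c \<le> \<epsilon> * t" using assms by (simp add: t_def)
  also have "\<epsilon> * t < exp (\<epsilon> * t)" using exp_ge_add_one_self[of "\<epsilon> * t"] by linarith
  finally show "c < exp (\<epsilon> * t)" .
qed

text \<open>
  Uniform boundedness of the projections is not part of a dichotomy, but it follows from the growth
  bound. If \<open>p = P \<theta> x\<close> were much larger than \<open>x\<close>, then \<open>p\<close> and \<open>p - x\<close> would be two nearly equal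
  vectors, one contracted and the other expanded. At a fixed time their images differ by a definite
  amount, whereas \<open>\<Phi>\<close> can magnify the small difference \<open>x\<close> only by a bounded factor.
\<close>

lemma dichotomy_projections_bounded:
  assumes "cocycle \<phi> \<Phi>" "dichotomy_on \<phi> \<Phi> \<mu> UNIV P"
  obtains N where "N \<ge> 0" "\<And>\<theta> x. norm (blinfun_apply (P \<theta>) x) \<le> N * norm x"
proof -
  obtain \<epsilon> M where \<epsilon>M: "\<epsilon> > 0" "M > 0" and sp: "\<And>\<theta>. splits_at \<phi> \<Phi> P (\<mu> - \<epsilon>) (\<mu> + \<epsilon>) M \<theta>"
    using assms by (auto simp: dichotomy_on_def)
  obtain K \<omega> where K: "K > 0" "\<And>t \<theta>. t \<ge> 0 \<Longrightarrow> norm (\<Phi> t \<theta>) \<le> K * exp (\<omega> * t)"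
    using cocycle_exponential_bound[OF assms(1)] by blast
  \<comment> \<open>at this time the upper bound on ranges is at most half the lower bound on kernels\<close>
  obtain t where t: "t \<ge> 0" "2 * M * M < exp ((2 * \<epsilon>) * t)"
    using exp_eventually_large[of "2 * \<epsilon>" "2 * M * M"] \<epsilon>M by auto
  define E where "E = exp ((\<mu> + \<epsilon>) * t)"
  define N where "N = 2 * (M * K * exp (\<omega> * t) + E) / E"
  have E: "E > 0" by (simp add: E_def)
  have decay: "M * (M * exp ((\<mu> - \<epsilon>) * t)) \<le> E / 2"
  proof -
    have "exp ((2 * \<epsilon>) * t) * exp ((\<mu> - \<epsilon>) * t) = E"
      by (simp add: E_def algebra_simps flip: exp_add)
    with mult_right_mono[OF less_imp_le[OF t(2)], of "exp ((\<mu> - \<epsilon>) * t)"]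
    have "2 * M * M * exp ((\<mu> - \<epsilon>) * t) \<le> E" by simp
    then show ?thesis by (simp add: mult_ac)
  qed
  have "norm (P \<theta> x) \<le> N * norm x" for \<theta> x
  proof -
    define p q where "p = P \<theta> x" and "q = x - p"
    have PP: "P \<theta> (P \<theta> x) = P \<theta> x"
      by (rule splits_atD(2)[OF sp])
    have p: "norm (\<Phi> t \<theta> p) \<le> M * exp ((\<mu> - \<epsilon>) * t) * norm p"
      and q: "E * norm q \<le> M * norm (\<Phi> t \<theta> q)"
      using splits_atD(5)[OF sp t(1)] splits_atD(6)[OF sp t(1), of \<theta> q] PP
      by (auto simp: E_def p_def q_def blinfun.diff_right)
    have "norm (\<Phi> t \<theta> x) \<le> K * exp (\<omega> * t) * norm x"
      using norm_blinfun[of "\<Phi> t \<theta>" x] mult_right_mono[OF K(2)[OF t(1), of \<theta>], of "norm x"]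
      by simp
    moreover have "\<Phi> t \<theta> q = \<Phi> t \<theta> x - \<Phi> t \<theta> p" by (simp add: q_def blinfun.diff_right)
    ultimately have "norm (\<Phi> t \<theta> q) \<le> K * exp (\<omega> * t) * norm x + M * exp ((\<mu> - \<epsilon>) * t) * norm p"
      using p norm_triangle_ineq4[of "\<Phi> t \<theta> x" "\<Phi> t \<theta> p"] by simp
    from mult_left_mono[OF this, of M] q \<epsilon>M
    have "E * norm q \<le> M * K * exp (\<omega> * t) * norm x + M * (M * exp ((\<mu> - \<epsilon>) * t)) * norm p"
      by (simp add: algebra_simps)
    also have "\<dots> \<le> M * K * exp (\<omega> * t) * norm x + E / 2 * norm p"
      using mult_right_mono[OF decay, of "norm p"] by simp
    finally have "E * norm q \<le> M * K * exp (\<omega> * t) * norm x + E / 2 * norm p" .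
    moreover have "E * norm p \<le> E * (norm x + norm q)"
      using E norm_triangle_ineq4[of x q] by (auto simp: q_def)
    ultimately have "E * norm p \<le> 2 * (M * K * exp (\<omega> * t) + E) * norm x"
      by (simp add: algebra_simps)
    then show ?thesis
      using E by (simp add: N_def p_def field_simps)
  qed
  moreover have "N \<ge> 0" using E K \<epsilon>M by (simp add: N_def)
  ultimately show ?thesis by (rule that[rotated])
qed

text \<open>
  A vector in the kernel of \<open>P \<theta>\<close> has preimages \<open>y\<close> arbitrarily far back, and they decay faster than
  \<open>exp (- \<mu> * t)\<close>. The vector \<open>Q \<theta> x\<close> is the image of \<open>Q y\<close>, where \<open>Q\<close> is taken at the earlier point;
  the bound on the projections controls \<open>Q y\<close>, and its growth is slower than \<open>exp (\<mu> * t)\<close>. Hence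
  \<open>Q \<theta> x\<close> is arbitrarily small. By symmetry the kernels of two dichotomies at the same rate agree.
\<close>

lemma dichotomy_kernels_subset:
  assumes flow: "continuous_flow \<phi>" and coc: "cocycle \<phi> \<Phi>"
    and P: "dichotomy_on \<phi> \<Phi> \<mu> UNIV P" and Q: "dichotomy_on \<phi> \<Phi> \<mu> UNIV Q"
    and x: "blinfun_apply (P \<theta>) x = 0"
  shows "blinfun_apply (Q \<theta>) x = 0"
proof (rule ccontr)
  assume nz: "Q \<theta> x \<noteq> 0"
  obtain \<epsilon>1 M1 where 1: "\<epsilon>1 > 0" "M1 > 0" "\<And>\<theta>. splits_at \<phi> \<Phi> P (\<mu> - \<epsilon>1) (\<mu> + \<epsilon>1) M1 \<theta>"
    using P by (auto simp: dichotomy_on_def)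
  obtain \<epsilon>2 M2 where 2: "\<epsilon>2 > 0" "M2 > 0" "\<And>\<theta>. splits_at \<phi> \<Phi> Q (\<mu> - \<epsilon>2) (\<mu> + \<epsilon>2) M2 \<theta>"
    using Q by (auto simp: dichotomy_on_def)
  obtain N where N: "N \<ge> 0" "\<And>\<theta> x. norm (Q \<theta> x) \<le> N * norm x"
    using dichotomy_projections_bounded[OF coc Q] by blast
  obtain t where t: "t \<ge> 0" "M2 * N * M1 * norm x / norm (Q \<theta> x) < exp ((\<epsilon>1 + \<epsilon>2) * t)"
    using exp_eventually_large[of "\<epsilon>1 + \<epsilon>2"] 1(1) 2(1) by (metis add_pos_pos)
  define \<eta> where "\<eta> = \<phi> (- t) \<theta>"
  have \<eta>: "\<phi> t \<eta> = \<theta>"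
    using flow by (auto simp: \<eta>_def continuous_flow_def)
  have "bij_betw (\<Phi> t \<eta>) {y. P \<eta> y = 0} {y. P \<theta> y = 0}"
    using splits_atD(4)[OF 1(3) t(1), of \<eta>] \<eta> by simp
  then obtain y where y: "P \<eta> y = 0" "\<Phi> t \<eta> y = x"
    using x unfolding bij_betw_def by (metis (mono_tags, lifting) imageE mem_Collect_eq)
  have "Q \<theta> x = \<Phi> t \<eta> (Q \<eta> y)"
    using splits_atD(3)[OF 2(3) t(1), of \<eta> y] \<eta> y(2) by simp
  moreover have "Q \<eta> (Q \<eta> y) = Q \<eta> y"
    by (rule splits_atD(2)[OF 2(3)])
  ultimately have "norm (Q \<theta> x) \<le> M2 * exp ((\<mu> - \<epsilon>2) * t) * norm (Q \<eta> y)"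
    using splits_atD(5)[OF 2(3) t(1)] by simp
  also have "\<dots> \<le> M2 * exp ((\<mu> - \<epsilon>2) * t) * (N * norm y)"
    using N 2(2) by (intro mult_left_mono) auto
  finally have a: "norm (Q \<theta> x) \<le> M2 * N * (exp ((\<mu> - \<epsilon>2) * t) * norm y)"
    by (simp add: mult_ac)
  have b: "exp ((\<mu> + \<epsilon>1) * t) * norm y \<le> M1 * norm x"
    using splits_atD(6)[OF 1(3) t(1) y(1)] y(2) by simp
  have "exp ((\<epsilon>1 + \<epsilon>2) * t) * norm (Q \<theta> x)
      \<le> exp ((\<epsilon>1 + \<epsilon>2) * t) * (M2 * N * (exp ((\<mu> - \<epsilon>2) * t) * norm y))"
    using a by (intro mult_left_mono) auto
  also have "\<dots> = M2 * N * (exp ((\<mu> + \<epsilon>1) * t) * norm y)"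
    by (simp add: algebra_simps flip: exp_add)
  also have "\<dots> \<le> M2 * N * (M1 * norm x)"
    using b N 2(2) by (intro mult_left_mono) auto
  finally show False
    using t(2) nz by (simp add: field_simps)
qed

section \<open>Dichotomies of scalar cocycles\<close>

text \<open>
  A projection of the complex line is \<open>0\<close> or \<open>1\<close>, and by continuity \<open>S\<close>, the set where it is \<open>1\<close>, is
  clopen. Since \<open>C\<close> may vanish on \<open>S\<close>, the commutation rule does not show that \<open>S\<close> is forward
  invariant; that comes from the surjectivity of the cocycle between the kernels. Off \<open>S\<close> the lower
  bound makes \<open>C\<close> nonzero, and there the commutation rule suffices.
\<close>

lemma scalar_dichotomy_split:
  assumes "dichotomy_on \<phi> (scalar_cocycle_op C) \<mu> UNIV P"
  obtains S \<epsilon> M where "invariant_clopen \<phi> S" "\<epsilon> > 0" "M > 0"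
    "\<And>\<theta> t. \<theta> \<in> S \<Longrightarrow> t \<ge> 0 \<Longrightarrow> cmod (C t \<theta>) \<le> M * exp ((\<mu> - \<epsilon>) * t)"
    "\<And>\<theta> t. \<theta> \<notin> S \<Longrightarrow> t \<ge> 0 \<Longrightarrow> exp ((\<mu> + \<epsilon>) * t) \<le> M * cmod (C t \<theta>)"
proof -
  obtain \<epsilon> M where *: "\<epsilon> > 0" "M > 0"
      "\<And>\<theta>. splits_at \<phi> (scalar_cocycle_op C) P (\<mu> - \<epsilon>) (\<mu> + \<epsilon>) M \<theta>"
    and cont: "continuous_on UNIV (\<lambda>\<theta>. P \<theta> 1)"
    using assms by (auto simp: dichotomy_on_def)
  define S where "S = {\<theta>. P \<theta> 1 = 1}"
  have app: "P \<theta> c = c * P \<theta> 1" for \<theta> c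
    using splits_atD(1)[OF *(3), of \<theta> c 1] by (simp add: scaleC_complex_def)
  have C: "scalar_cocycle_op C t \<theta> c = C t \<theta> * c" for t \<theta> c
    by (simp add: scalar_cocycle_op_def scalar_op.rep_eq scaleC_complex_def)
  have zero_one: "P \<theta> 1 = 0" if "\<theta> \<notin> S" for \<theta>
  proof -
    have "P \<theta> (P \<theta> 1) = P \<theta> 1"
      by (rule splits_atD(2)[OF *(3)])
    then have "P \<theta> 1 * P \<theta> 1 = P \<theta> 1" using app[of \<theta> "P \<theta> 1"] by simp
    then show ?thesis using that by (simp add: S_def)
  qed
  have lower: "exp ((\<mu> + \<epsilon>) * t) \<le> M * cmod (C t \<theta>)" if "\<theta> \<notin> S" "t \<ge> 0" for \<theta> t
  proof -
    have "exp ((\<mu> + \<epsilon>) * t) * cmod 1 \<le> M * cmod (scalar_cocycle_op C t \<theta> 1)"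
      by (rule splits_atD(6)[OF *(3) that(2) zero_one[OF that(1)]])
    then show ?thesis by (simp add: C)
  qed
  have upper: "cmod (C t \<theta>) \<le> M * exp ((\<mu> - \<epsilon>) * t)" if "\<theta> \<in> S" "t \<ge> 0" for \<theta> t
  proof -
    have "cmod (scalar_cocycle_op C t \<theta> 1) \<le> M * exp ((\<mu> - \<epsilon>) * t) * cmod 1"
      using that(1) by (intro splits_atD(5)[OF *(3) that(2)]) (simp add: S_def)
    then show ?thesis by (simp add: C)
  qed
  have "closed S"
    unfolding S_def by (intro closed_Collect_eq cont continuous_on_const)
  moreover have "- S = {\<theta>. P \<theta> 1 = 0}"
    using zero_one by (auto simp: S_def)
  then have "closed (- S)"
    by (simp add: closed_Collect_eq cont continuous_on_const)
  moreover have "\<phi> t \<theta> \<in> S \<longleftrightarrow> \<theta> \<in> S" if t: "t \<ge> 0" for t \<theta>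
  proof
    assume "\<theta> \<in> S"
    then have "P \<theta> c = c" for c using app[of \<theta> c] by (simp add: S_def)
    then have "{c. P \<theta> c = 0} = {0}" by simp
    moreover have "bij_betw (scalar_cocycle_op C t \<theta>) {c. P \<theta> c = 0} {c. P (\<phi> t \<theta>) c = 0}"
      by (rule splits_atD(4)[OF *(3) t])
    ultimately have "{c. P (\<phi> t \<theta>) c = 0} = {0}"
      unfolding bij_betw_def by (simp add: C)
    then have "P (\<phi> t \<theta>) 1 \<noteq> 0" by (simp add: set_eq_iff)
    then show "\<phi> t \<theta> \<in> S" using zero_one[of "\<phi> t \<theta>"] by blast
  next
    assume image: "\<phi> t \<theta> \<in> S"
    show "\<theta> \<in> S"
    proof (rule ccontr)
      assume n: "\<theta> \<notin> S"
      have "scalar_cocycle_op C t \<theta> (P \<theta> 1) = P (\<phi> t \<theta>) (scalar_cocycle_op C t \<theta> 1)"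
        using splits_atD(3)[OF *(3)[of \<theta>] t, of 1] .
      then have "P (\<phi> t \<theta>) (C t \<theta>) = 0"
        by (simp only: C zero_one[OF n] mult_zero_right mult_1_right)
      moreover have "P (\<phi> t \<theta>) 1 = 1" using image by (simp only: S_def mem_Collect_eq)
      ultimately have "C t \<theta> = 0"
        using app[of "\<phi> t \<theta>" "C t \<theta>"] by (simp only: mult_1_right)
      then show False using lower[OF n t] by simp
    qed
  qed
  ultimately have "invariant_clopen \<phi> S" by (auto simp: invariant_clopen_def)
  then show ?thesis using that *(1,2) upper lower by blast
qed

section \<open>Partial dichotomies of the product cocycle\<close>

lemma product_cocycle_apply:
  "blinfun_apply (product_cocycle C \<Phi> t \<theta>) x = C t \<theta> *\<^sub>C blinfun_apply (\<Phi> t \<theta>) x"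
  by (simp add: product_cocycle_def scalar_op.rep_eq)

lemma scaleC_zero_left: "0 *\<^sub>C x = (0 :: 'x::complex_banach)"
  using scaleC_of_real[of 0 x] by simp

lemma scaleC_zero_right: "c *\<^sub>C 0 = (0 :: 'x::complex_banach)"
  using norm_scaleC[of c "0 :: 'x"] by simp

lemma scaleC_one: "1 *\<^sub>C x = (x :: 'x::complex_banach)"
  using scaleC_of_real[of 1 x] by simp

text \<open>
  The two conditions on the complement of \<open>U\<close> are counterparts of each other: the first speaks of the
  scalar factor alone and is useful at rates \<open>\<mu>\<close> where \<open>C\<close> has a dichotomy, the second involves the
  projections of \<open>\<Phi>\<close> and is useful where \<open>\<Phi>\<close> has a dichotomy at the complementary rate \<open>l - \<mu>\<close>.
\<close>

definition scalar_expanding_remainder ::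
    "(real \<Rightarrow> 'th::topological_space \<Rightarrow> 'th) \<Rightarrow> (real \<Rightarrow> 'th \<Rightarrow> ('x::complex_banach \<Rightarrow>\<^sub>L 'x)) \<Rightarrow>
     (real \<Rightarrow> 'th \<Rightarrow> complex) \<Rightarrow> real \<Rightarrow> real \<Rightarrow> bool"
  where "scalar_expanding_remainder \<phi> \<Phi> C l \<mu> \<longleftrightarrow>
    (\<exists>U R M. invariant_clopen \<phi> U \<and> dichotomy_on \<phi> (product_cocycle C \<Phi>) l U R \<and> M > 0 \<and>
      (\<forall>\<theta>\<in>- U. \<forall>t\<ge>0. exp (\<mu> * t) \<le> M * cmod (C t \<theta>)))"

definition kernel_expanding_remainder ::
    "(real \<Rightarrow> 'th::topological_space \<Rightarrow> 'th) \<Rightarrow> (real \<Rightarrow> 'th \<Rightarrow> ('x::complex_banach \<Rightarrow>\<^sub>L 'x)) \<Rightarrow>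
     (real \<Rightarrow> 'th \<Rightarrow> complex) \<Rightarrow> real \<Rightarrow> real \<Rightarrow> bool"
  where "kernel_expanding_remainder \<phi> \<Phi> C l \<mu> \<longleftrightarrow>
    (\<exists>U R P \<epsilon> M. invariant_clopen \<phi> U \<and> dichotomy_on \<phi> (product_cocycle C \<Phi>) l U R \<and>
      dichotomy_on \<phi> \<Phi> (l - \<mu>) UNIV P \<and> \<epsilon> > 0 \<and> M > 0 \<and>
      (\<forall>\<theta>\<in>- U. \<forall>t\<ge>0. \<forall>x. blinfun_apply (P \<theta>) x = 0 \<longrightarrow>
        exp ((l + \<epsilon>) * t) * norm x \<le> M * norm (blinfun_apply (product_cocycle C \<Phi> t \<theta>) x)))"

lemma scalar_imp_kernel_expanding_remainder:
  assumes "scalar_expanding_remainder \<phi> \<Phi> C l \<mu>" "dichotomy_on \<phi> \<Phi> (l - \<mu>) UNIV P"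
  shows "kernel_expanding_remainder \<phi> \<Phi> C l \<mu>"
proof -
  obtain U R M where U: "invariant_clopen \<phi> U" "dichotomy_on \<phi> (product_cocycle C \<Phi>) l U R"
    "M > 0" "\<And>\<theta> t. \<theta> \<notin> U \<Longrightarrow> t \<ge> 0 \<Longrightarrow> exp (\<mu> * t) \<le> M * cmod (C t \<theta>)"
    using assms(1) by (auto simp: scalar_expanding_remainder_def)
  obtain \<epsilon> M' where P: "\<epsilon> > 0" "M' > 0"
    "\<And>\<theta>. splits_at \<phi> \<Phi> P (l - \<mu> - \<epsilon>) (l - \<mu> + \<epsilon>) M' \<theta>"
    using assms(2) by (auto simp: dichotomy_on_def)
  have "exp ((l + \<epsilon>) * t) * norm x \<le> (M * M') * norm (product_cocycle C \<Phi> t \<theta> x)"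
    if "\<theta> \<notin> U" "t \<ge> 0" "P \<theta> x = 0" for \<theta> t x
  proof -
    have "exp ((l - \<mu> + \<epsilon>) * t) * norm x \<le> M' * norm (\<Phi> t \<theta> x)"
      by (rule splits_atD(6)[OF P(3) that(2,3)])
    moreover have "exp ((l + \<epsilon>) * t) * norm x = exp (\<mu> * t) * (exp ((l - \<mu> + \<epsilon>) * t) * norm x)"
      by (simp add: algebra_simps flip: exp_add)
    ultimately have "exp ((l + \<epsilon>) * t) * norm x \<le> (M * cmod (C t \<theta>)) * (M' * norm (\<Phi> t \<theta> x))"
      using mult_mono[OF U(4)[OF that(1,2)], of "exp ((l - \<mu> + \<epsilon>) * t) * norm x" "M' * norm (\<Phi> t \<theta> x)"] U(3)
      by (simp only:) (simp add: less_imp_le)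
    then show ?thesis by (simp add: product_cocycle_apply norm_scaleC mult_ac)
  qed
  moreover have "M * M' > 0" using U P by simp
  ultimately show ?thesis
    unfolding kernel_expanding_remainder_def using U(1,2) assms(2) P(1) by (metis ComplD)
qed

text \<open>
  On ranges the growth rates of \<open>C\<close>, below \<open>\<mu>\<close>, and of \<open>\<Phi>\<close>, below \<open>l - \<mu>\<close>, add up. The expansion on the kernels is
  assumed for the product, and it also provides the invertibility: unless a kernel is zero, the lower
  bound forces \<open>C\<close> to be nonzero.
\<close>

lemma product_dichotomy_on_stable_part:
  assumes P: "dichotomy_on \<phi> \<Phi> (l - \<mu>) UNIV P" and coc: "cocycle \<phi> \<Phi>"
    and pos: "\<epsilon>1 > 0" "M1 > 0" "\<epsilon>2 > 0" "M2 > 0"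
    and up: "\<And>\<theta> t. \<theta> \<in> V \<Longrightarrow> t \<ge> 0 \<Longrightarrow> cmod (C t \<theta>) \<le> M1 * exp ((\<mu> - \<epsilon>1) * t)"
    and low: "\<And>\<theta> t x. \<theta> \<in> V \<Longrightarrow> t \<ge> 0 \<Longrightarrow> blinfun_apply (P \<theta>) x = 0 \<Longrightarrow>
      exp ((l + \<epsilon>2) * t) * norm x \<le> M2 * norm (blinfun_apply (product_cocycle C \<Phi> t \<theta>) x)"
  shows "dichotomy_on \<phi> (product_cocycle C \<Phi>) l V P"
proof -
  obtain \<epsilon> M where sp: "\<epsilon> > 0" "M > 0" "\<And>\<theta>. splits_at \<phi> \<Phi> P (l - \<mu> - \<epsilon>) (l - \<mu> + \<epsilon>) M \<theta>"
    using P by (auto simp: dichotomy_on_def)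
  have clin: "P \<theta> (c *\<^sub>C x) = c *\<^sub>C P \<theta> x" for \<theta> c x
    by (rule splits_atD(1)[OF sp(3)])
  have clinPhi: "\<Phi> t \<theta> (c *\<^sub>C x) = c *\<^sub>C \<Phi> t \<theta> x" if "t \<ge> 0" for t \<theta> c x
    using coc that by (auto simp: cocycle_def clinear_op_def)
  have comm: "\<Phi> t \<theta> (P \<theta> x) = P (\<phi> t \<theta>) (\<Phi> t \<theta> x)" if "t \<ge> 0" for t \<theta> x
    by (rule splits_atD(3)[OF sp(3) that])
  have "splits_at \<phi> (product_cocycle C \<Phi>) P (l - (\<epsilon> + \<epsilon>1)) (l + \<epsilon>2) (max (M1 * M) M2) \<theta>"
    if V: "\<theta> \<in> V" for \<theta>
    unfolding splits_at_def
  proof (intro conjI allI impI)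
    show "clinear_op (P \<theta>)" "P \<theta> o\<^sub>L P \<theta> = P \<theta>"
      using sp(3)[of \<theta>] by (auto simp: splits_at_def)
    fix t :: real assume t: "t \<ge> 0"
    show "product_cocycle C \<Phi> t \<theta> o\<^sub>L P \<theta> = P (\<phi> t \<theta>) o\<^sub>L product_cocycle C \<Phi> t \<theta>"
      by (rule blinfun_eqI) (simp add: product_cocycle_apply comm[OF t] clin)
    show "norm (product_cocycle C \<Phi> t \<theta> x) \<le> max (M1 * M) M2 * exp ((l - (\<epsilon> + \<epsilon>1)) * t) * norm x"
      if x: "P \<theta> x = x" for x
    proof -
      have "norm (product_cocycle C \<Phi> t \<theta> x) = cmod (C t \<theta>) * norm (\<Phi> t \<theta> x)"
        by (simp add: product_cocycle_apply norm_scaleC)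
      also have "\<dots> \<le> (M1 * exp ((\<mu> - \<epsilon>1) * t)) * (M * exp ((l - \<mu> - \<epsilon>) * t) * norm x)"
        using splits_atD(5)[OF sp(3) t x] up[OF V t] pos by (intro mult_mono) auto
      also have "\<dots> = (M1 * M) * exp ((l - (\<epsilon> + \<epsilon>1)) * t) * norm x"
        by (simp add: algebra_simps flip: exp_add)
      also have "\<dots> \<le> max (M1 * M) M2 * exp ((l - (\<epsilon> + \<epsilon>1)) * t) * norm x"
        by (intro mult_right_mono) auto
      finally show ?thesis .
    qed
    show "exp ((l + \<epsilon>2) * t) * norm x \<le> max (M1 * M) M2 * norm (product_cocycle C \<Phi> t \<theta> x)"
      if x: "P \<theta> x = 0" for x
    proof -
      have "M2 * norm (product_cocycle C \<Phi> t \<theta> x) \<le> max (M1 * M) M2 * norm (product_cocycle C \<Phi> t \<theta> x)"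
        by (intro mult_right_mono) auto
      with low[OF V t x] show ?thesis by linarith
    qed
    show "bij_betw (product_cocycle C \<Phi> t \<theta>) {x. P \<theta> x = 0} {x. P (\<phi> t \<theta>) x = 0}"
      unfolding bij_betw_def
    proof
      show "inj_on (product_cocycle C \<Phi> t \<theta>) {x. P \<theta> x = 0}"
      proof (rule inj_onI, clarsimp)
        fix x y assume xy: "P \<theta> x = 0" "P \<theta> y = 0" "product_cocycle C \<Phi> t \<theta> x = product_cocycle C \<Phi> t \<theta> y"
        then have "exp ((l + \<epsilon>2) * t) * norm (x - y) \<le> 0"
          using low[OF V t, of "x - y"] by (simp add: blinfun.diff_right)
        then show "x = y" by (simp add: mult_le_0_iff)
      qed
      have im: "\<Phi> t \<theta> ` {x. P \<theta> x = 0} = {x. P (\<phi> t \<theta>) x = 0}"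
        using splits_atD(4)[OF sp(3) t, of \<theta>] by (simp add: bij_betw_def)
      show "product_cocycle C \<Phi> t \<theta> ` {x. P \<theta> x = 0} = {x. P (\<phi> t \<theta>) x = 0}"
      proof (intro equalityI subsetI)
        fix y assume "y \<in> product_cocycle C \<Phi> t \<theta> ` {x. P \<theta> x = 0}"
        then obtain x where "P \<theta> x = 0" "y = C t \<theta> *\<^sub>C \<Phi> t \<theta> x"
          by (auto simp: product_cocycle_apply)
        then show "y \<in> {x. P (\<phi> t \<theta>) x = 0}"
          using comm[OF t, of \<theta> x] by (simp add: clin blinfun.zero_right scaleC_zero_right)
      next
        fix y assume "y \<in> {x. P (\<phi> t \<theta>) x = 0}"
        then obtain x where x: "P \<theta> x = 0" "y = \<Phi> t \<theta> x" using im by blast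
        show "y \<in> product_cocycle C \<Phi> t \<theta> ` {x. P \<theta> x = 0}"
        proof (cases "x = 0")
          case True
          then show ?thesis using x by (auto simp: blinfun.zero_right intro!: image_eqI[of _ _ 0])
        next
          case False
          have "C t \<theta> \<noteq> 0"
          proof
            assume "C t \<theta> = 0"
            then show False
              using low[OF V t x(1)] False
              by (simp add: product_cocycle_apply scaleC_zero_left mult_le_0_iff)
          qed
          then have "y = product_cocycle C \<Phi> t \<theta> (inverse (C t \<theta>) *\<^sub>C x)"
            using x(2) by (simp add: product_cocycle_apply clinPhi[OF t] scaleC_scaleC scaleC_one)
          moreover have "P \<theta> (inverse (C t \<theta>) *\<^sub>C x) = 0"
            using x(1) by (simp add: clin scaleC_zero_right)
          ultimately show ?thesis by blast
        qed
      qed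
    qed
  qed
  then have "splits_at \<phi> (product_cocycle C \<Phi>) P (l - min (\<epsilon> + \<epsilon>1) \<epsilon>2) (l + min (\<epsilon> + \<epsilon>1) \<epsilon>2)
      (max (M1 * M) M2) \<theta>" if "\<theta> \<in> V" for \<theta>
    by (rule splits_at_mono) (use that pos(4) in auto)
  moreover have "min (\<epsilon> + \<epsilon>1) \<epsilon>2 > 0" "max (M1 * M) M2 > 0" using pos sp by auto
  moreover have "\<forall>x. continuous_on V (\<lambda>\<theta>. P \<theta> x)"
    using P by (auto simp: dichotomy_on_def intro: continuous_on_subset)
  ultimately show ?thesis
    unfolding dichotomy_on_def by blast
qed

text \<open>
  The part of the complement of \<open>U\<close> over which \<open>C\<close> is slow is added to \<open>U\<close>; over what then remains \<open>C\<close>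
  is fast.
\<close>

lemma kernel_imp_scalar_expanding_remainder:
  assumes "kernel_expanding_remainder \<phi> \<Phi> C l \<mu>" "dichotomy_on \<phi> (scalar_cocycle_op C) \<mu> UNIV PC"
    and coc: "cocycle \<phi> \<Phi>"
  shows "scalar_expanding_remainder \<phi> \<Phi> C l \<mu>"
proof -
  obtain U R P \<epsilon> M where U: "invariant_clopen \<phi> U" "dichotomy_on \<phi> (product_cocycle C \<Phi>) l U R"
    "dichotomy_on \<phi> \<Phi> (l - \<mu>) UNIV P" "\<epsilon> > 0" "M > 0"
    "\<And>\<theta> t x. \<theta> \<notin> U \<Longrightarrow> t \<ge> 0 \<Longrightarrow> P \<theta> x = 0 \<Longrightarrow>
        exp ((l + \<epsilon>) * t) * norm x \<le> M * norm (product_cocycle C \<Phi> t \<theta> x)"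
    using assms(1) by (auto simp: kernel_expanding_remainder_def)
  obtain S \<epsilon>' M' where S: "invariant_clopen \<phi> S" "\<epsilon>' > 0" "M' > 0"
    "\<And>\<theta> t. \<theta> \<in> S \<Longrightarrow> t \<ge> 0 \<Longrightarrow> cmod (C t \<theta>) \<le> M' * exp ((\<mu> - \<epsilon>') * t)"
    "\<And>\<theta> t. \<theta> \<notin> S \<Longrightarrow> t \<ge> 0 \<Longrightarrow> exp ((\<mu> + \<epsilon>') * t) \<le> M' * cmod (C t \<theta>)"
    using scalar_dichotomy_split[OF assms(2)] by blast
  define V where "V = S - U"
  have V: "invariant_clopen \<phi> V" "invariant_clopen \<phi> (U \<union> V)"
    using U(1) S(1) by (auto simp: V_def invariant_clopen_def Diff_eq intro: closed_Un closed_Int)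
  have "dichotomy_on \<phi> (product_cocycle C \<Phi>) l V P"
    using U(6) S(4)
    by (intro product_dichotomy_on_stable_part[OF U(3) coc S(2,3) U(4,5)]) (auto simp: V_def)
  then have "\<exists>R'. dichotomy_on \<phi> (product_cocycle C \<Phi>) l (U \<union> V) R'"
    using dichotomy_on_union[OF U(2,1) _ V(1)] by (auto simp: V_def)
  moreover have "exp (\<mu> * t) \<le> M' * cmod (C t \<theta>)" if "\<theta> \<in> - (U \<union> V)" "t \<ge> 0" for \<theta> t
  proof -
    have "exp (\<mu> * t) \<le> exp ((\<mu> + \<epsilon>') * t)" using that S(2) by (auto intro: mult_right_mono)
    also have "\<dots> \<le> M' * cmod (C t \<theta>)" using S(5) that by (auto simp: V_def)
    finally show ?thesis .
  qed
  ultimately show ?thesis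
    unfolding scalar_expanding_remainder_def using V(2) S(3) by blast
qed

text \<open>
  For \<open>\<mu>1\<close> close to \<open>\<mu>\<close>, growth like \<open>exp (\<mu>1 * t)\<close> excludes the points where \<open>C\<close> is slower than
  \<open>exp ((\<mu> - \<epsilon>) * t)\<close>. So the complement of \<open>U\<close> lies in the fast part, where the growth is at least
  \<open>exp ((\<mu> + \<epsilon>) * t)\<close>, which is enough for every rate up to \<open>\<mu> + \<epsilon>\<close>.
\<close>

lemma scalar_expanding_remainder_locally_constant:
  assumes "dichotomy_on \<phi> (scalar_cocycle_op C) \<mu> UNIV PC"
  shows "\<exists>\<delta>>0. \<forall>\<mu>'. \<bar>\<mu>' - \<mu>\<bar> < \<delta> \<longrightarrow>
    scalar_expanding_remainder \<phi> \<Phi> C l \<mu>' = scalar_expanding_remainder \<phi> \<Phi> C l \<mu>"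
proof -
  obtain S \<epsilon> M where S: "invariant_clopen \<phi> S" "\<epsilon> > 0" "M > 0"
    "\<And>\<theta> t. \<theta> \<in> S \<Longrightarrow> t \<ge> 0 \<Longrightarrow> cmod (C t \<theta>) \<le> M * exp ((\<mu> - \<epsilon>) * t)"
    "\<And>\<theta> t. \<theta> \<notin> S \<Longrightarrow> t \<ge> 0 \<Longrightarrow> exp ((\<mu> + \<epsilon>) * t) \<le> M * cmod (C t \<theta>)"
    using scalar_dichotomy_split[OF assms(1)] by blast
  have *: "scalar_expanding_remainder \<phi> \<Phi> C l \<mu>2"
    if \<mu>: "\<bar>\<mu>1 - \<mu>\<bar> < \<epsilon>" "\<bar>\<mu>2 - \<mu>\<bar> < \<epsilon>" and r: "scalar_expanding_remainder \<phi> \<Phi> C l \<mu>1" for \<mu>1 \<mu>2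
  proof -
    obtain U R M' where U: "invariant_clopen \<phi> U" "dichotomy_on \<phi> (product_cocycle C \<Phi>) l U R"
      "M' > 0" "\<And>\<theta> t. \<theta> \<notin> U \<Longrightarrow> t \<ge> 0 \<Longrightarrow> exp (\<mu>1 * t) \<le> M' * cmod (C t \<theta>)"
      using r by (auto simp: scalar_expanding_remainder_def)
    have "exp (\<mu>2 * t) \<le> M * cmod (C t \<theta>)" if \<theta>: "\<theta> \<notin> U" "t \<ge> 0" for \<theta> t
    proof -
      have "\<theta> \<notin> S"
      proof
        assume "\<theta> \<in> S"
        obtain s where s: "s \<ge> 0" "M' * M < exp ((\<mu>1 - (\<mu> - \<epsilon>)) * s)"
        proof (rule exp_eventually_large)
          show "\<mu>1 - (\<mu> - \<epsilon>) > 0" using \<mu> by linarith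
        qed
        have "exp ((\<mu>1 - (\<mu> - \<epsilon>)) * s) * exp ((\<mu> - \<epsilon>) * s) = exp (\<mu>1 * s)"
          by (simp add: algebra_simps flip: exp_add)
        also have "\<dots> \<le> M' * cmod (C s \<theta>)" by (rule U(4)[OF \<theta>(1) s(1)])
        also have "\<dots> \<le> M' * (M * exp ((\<mu> - \<epsilon>) * s))"
          using S(4)[OF \<open>\<theta> \<in> S\<close> s(1)] U(3) by (intro mult_left_mono) auto
        finally show False using s(2) by (simp flip: mult.assoc)
      qed
      have "exp (\<mu>2 * t) \<le> exp ((\<mu> + \<epsilon>) * t)" using \<mu> \<theta> by (auto intro: mult_right_mono)
      also have "\<dots> \<le> M * cmod (C t \<theta>)" by (rule S(5)[OF \<open>\<theta> \<notin> S\<close> \<theta>(2)])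
      finally show ?thesis .
    qed
    then show ?thesis
      unfolding scalar_expanding_remainder_def using U(1,2) S(3) by blast
  qed
  have "\<bar>\<mu> - \<mu>\<bar> < \<epsilon>" using S(2) by simp
  then show ?thesis using *[of \<mu>] *[of _ \<mu>] S(2) by blast
qed

text \<open>
  Close to \<open>\<mu>\<close> the same \<open>P\<close> serves as projection, and by uniqueness of the kernels the expansion
  known on the kernels of any other choice \<open>Q\<close> holds on those of \<open>P\<close>.
\<close>

lemma kernel_expanding_remainder_locally_constant:
  assumes flow: "continuous_flow \<phi>" and coc: "cocycle \<phi> \<Phi>"
    and P: "dichotomy_on \<phi> \<Phi> (l - \<mu>) UNIV P"
  shows "\<exists>\<delta>>0. \<forall>\<mu>'. \<bar>\<mu>' - \<mu>\<bar> < \<delta> \<longrightarrow>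
    kernel_expanding_remainder \<phi> \<Phi> C l \<mu>' = kernel_expanding_remainder \<phi> \<Phi> C l \<mu>"
proof -
  obtain \<delta> where \<delta>: "\<delta> > 0" "\<forall>\<nu>. \<bar>\<nu> - (l - \<mu>)\<bar> < \<delta> \<longrightarrow> dichotomy_on \<phi> \<Phi> \<nu> UNIV P"
    using dichotomy_on_nearby[OF P] by blast
  have *: "kernel_expanding_remainder \<phi> \<Phi> C l \<mu>2"
    if \<mu>: "\<bar>\<mu>1 - \<mu>\<bar> < \<delta>" "\<bar>\<mu>2 - \<mu>\<bar> < \<delta>" and r: "kernel_expanding_remainder \<phi> \<Phi> C l \<mu>1" for \<mu>1 \<mu>2
  proof -
    have P12: "dichotomy_on \<phi> \<Phi> (l - \<mu>1) UNIV P" "dichotomy_on \<phi> \<Phi> (l - \<mu>2) UNIV P"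
      using \<mu> by (intro \<delta>(2)[rule_format]; linarith)+
    obtain U R Q \<epsilon> M where U: "invariant_clopen \<phi> U" "dichotomy_on \<phi> (product_cocycle C \<Phi>) l U R"
      "dichotomy_on \<phi> \<Phi> (l - \<mu>1) UNIV Q" "\<epsilon> > 0" "M > 0"
      "\<And>\<theta> t x. \<theta> \<notin> U \<Longrightarrow> t \<ge> 0 \<Longrightarrow> Q \<theta> x = 0 \<Longrightarrow>
          exp ((l + \<epsilon>) * t) * norm x \<le> M * norm (product_cocycle C \<Phi> t \<theta> x)"
      using r by (auto simp: kernel_expanding_remainder_def)
    have "Q \<theta> x = 0" if "P \<theta> x = 0" for \<theta> x
      by (rule dichotomy_kernels_subset[OF flow coc P12(1) U(3) that])
    then show ?thesis
      unfolding kernel_expanding_remainder_def using U P12(2) by (metis ComplD)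
  qed
  have "\<bar>\<mu> - \<mu>\<bar> < \<delta>" using \<delta>(1) by simp
  then show ?thesis using *[of \<mu>] *[of _ \<mu>] \<delta>(1) by blast
qed

section \<open>The spectrum of the product\<close>

theorem lemma4p1:
  fixes \<phi> :: "real \<Rightarrow> 'th::t2_space \<Rightarrow> 'th"
    and \<Phi> :: "real \<Rightarrow> 'th \<Rightarrow> ('x::complex_banach \<Rightarrow>\<^sub>L 'x)"
    and C :: "real \<Rightarrow> 'th \<Rightarrow> complex"
  assumes "locally_compact_space (euclidean :: 'th topology)"
    and "sigma_compact_space (euclidean :: 'th topology)"
    and "continuous_flow \<phi>"
    and "cocycle \<phi> \<Phi>"
    and "cocycle \<phi> (scalar_cocycle_op C)"
  shows "dynamical_spectrum \<phi> (product_cocycle C \<Phi>) \<subseteq>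
    {\<mu> + \<nu> | \<mu> \<nu>. \<mu> \<in> dynamical_spectrum \<phi> (scalar_cocycle_op C) \<and> \<nu> \<in> dynamical_spectrum \<phi> \<Phi>}"
proof (rule subsetI, rule ccontr)
  note flow = assms(3) and coc = assms(4)
  fix l assume l: "l \<in> dynamical_spectrum \<phi> (product_cocycle C \<Phi>)"
  define RC where "RC \<mu> \<longleftrightarrow> (\<exists>P. dichotomy_on \<phi> (scalar_cocycle_op C) \<mu> UNIV P)" for \<mu>
  define RPhi where "RPhi \<nu> \<longleftrightarrow> (\<exists>P. dichotomy_on \<phi> \<Phi> \<nu> UNIV P)" for \<nu>
  let ?F1 = "scalar_expanding_remainder \<phi> \<Phi> C l" and ?F2 = "kernel_expanding_remainder \<phi> \<Phi> C l"
  assume "l \<notin> {\<mu> + \<nu> | \<mu> \<nu>. \<mu> \<in> dynamical_spectrum \<phi> (scalar_cocycle_op C) \<and> \<nu> \<in> dynamical_spectrum \<phi> \<Phi>}"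
  moreover have "l = \<mu> + (l - \<mu>)" for \<mu> by simp
  ultimately have cover: "RC \<mu> \<or> RPhi (l - \<mu>)" for \<mu>
    unfolding RC_def RPhi_def not_in_dynamical_spectrum_iff[symmetric] by blast
  \<comment> \<open>where both alternatives apply, they are equivalent, so either of them decides \<open>G\<close>\<close>
  define G where "G \<mu> \<longleftrightarrow> (RC \<mu> \<longrightarrow> ?F1 \<mu>) \<and> (RPhi (l - \<mu>) \<longrightarrow> ?F2 \<mu>)" for \<mu>
  have G1: "G \<mu> \<longleftrightarrow> ?F1 \<mu>" if "RC \<mu>" for \<mu>
    using that scalar_imp_kernel_expanding_remainder unfolding G_def RPhi_def by blast
  have G2: "G \<mu> \<longleftrightarrow> ?F2 \<mu>" if "RPhi (l - \<mu>)" for \<mu>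
    using that kernel_imp_scalar_expanding_remainder coc unfolding G_def RC_def by blast
  have "\<exists>\<delta>>0. \<forall>\<mu>'. \<bar>\<mu>' - \<mu>\<bar> < \<delta> \<longrightarrow> G \<mu>' = G \<mu>" for \<mu>
  proof (cases "RC \<mu>")
    case True
    then obtain P where P: "dichotomy_on \<phi> (scalar_cocycle_op C) \<mu> UNIV P" unfolding RC_def by blast
    obtain \<delta>1 where 1: "\<delta>1 > 0" "\<forall>\<mu>'. \<bar>\<mu>' - \<mu>\<bar> < \<delta>1 \<longrightarrow> dichotomy_on \<phi> (scalar_cocycle_op C) \<mu>' UNIV P"
      using dichotomy_on_nearby[OF P] by blast
    obtain \<delta>2 where 2: "\<delta>2 > 0" "\<forall>\<mu>'. \<bar>\<mu>' - \<mu>\<bar> < \<delta>2 \<longrightarrow> ?F1 \<mu>' = ?F1 \<mu>"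
      using scalar_expanding_remainder_locally_constant[OF P] by blast
    have "G \<mu>' = G \<mu>" if "\<bar>\<mu>' - \<mu>\<bar> < min \<delta>1 \<delta>2" for \<mu>'
    proof -
      have d: "\<bar>\<mu>' - \<mu>\<bar> < \<delta>1" "\<bar>\<mu>' - \<mu>\<bar> < \<delta>2"
        using that by auto
      have "RC \<mu>'" unfolding RC_def using 1(2) d(1) by blast
      then show ?thesis using 2(2)[rule_format, OF d(2)] G1[OF True] G1[of \<mu>'] by simp
    qed
    moreover have "min \<delta>1 \<delta>2 > 0" using 1(1) 2(1) by simp
    ultimately show ?thesis by blast
  next
    case False
    then have R: "RPhi (l - \<mu>)" using cover by blast
    then obtain P where P: "dichotomy_on \<phi> \<Phi> (l - \<mu>) UNIV P" unfolding RPhi_def by blast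
    obtain \<delta>1 where 1: "\<delta>1 > 0" "\<forall>\<nu>. \<bar>\<nu> - (l - \<mu>)\<bar> < \<delta>1 \<longrightarrow> dichotomy_on \<phi> \<Phi> \<nu> UNIV P"
      using dichotomy_on_nearby[OF P] by blast
    obtain \<delta>2 where 2: "\<delta>2 > 0" "\<forall>\<mu>'. \<bar>\<mu>' - \<mu>\<bar> < \<delta>2 \<longrightarrow> ?F2 \<mu>' = ?F2 \<mu>"
      using kernel_expanding_remainder_locally_constant[OF flow coc P] by blast
    have "G \<mu>' = G \<mu>" if "\<bar>\<mu>' - \<mu>\<bar> < min \<delta>1 \<delta>2" for \<mu>'
    proof -
      have d: "\<bar>(l - \<mu>') - (l - \<mu>)\<bar> < \<delta>1" "\<bar>\<mu>' - \<mu>\<bar> < \<delta>2"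
        using that by auto
      have "RPhi (l - \<mu>')" unfolding RPhi_def using 1(2) d(1) by blast
      then show ?thesis using 2(2)[rule_format, OF d(2)] G2[OF R] G2[of \<mu>'] by simp
    qed
    moreover have "min \<delta>1 \<delta>2 > 0" using 1(1) 2(1) by simp
    ultimately show ?thesis by blast
  qed
  then have "eventually (\<lambda>\<mu>'. G \<mu> = G \<mu>') (at \<mu>)" for \<mu>
    unfolding eventually_at dist_real_def by blast
  then have const: "G \<mu> = G \<mu>'" for \<mu> \<mu>'
    by (intro connected_local_const[of UNIV]) simp_all
  obtain K \<omega> where K: "K > 0" "\<And>t \<theta>. t \<ge> 0 \<Longrightarrow> norm (\<Phi> t \<theta>) \<le> K * exp (\<omega> * t)"
    using cocycle_exponential_bound[OF coc] by blast
  \<comment> \<open>at this rate \<open>\<Phi>\<close> has only stable directions, so that \<open>U = {}\<close> is a valid start\<close>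
  define \<mu>0 where "\<mu>0 = l - (\<omega> + 1)"
  have D0: "dichotomy_on \<phi> \<Phi> (l - \<mu>0) UNIV (\<lambda>_. id_blinfun)"
    by (rule dichotomy_on_above_growth[OF K]) (auto simp: \<mu>0_def)
  have "invariant_clopen \<phi> {}" "dichotomy_on \<phi> (product_cocycle C \<Phi>) l {} (\<lambda>_. id_blinfun)"
    by (auto simp: invariant_clopen_def dichotomy_on_def intro: exI[of _ 1])
  then have "?F2 \<mu>0"
    unfolding kernel_expanding_remainder_def using D0
    by (intro exI[of _ "{}"] exI[of _ "\<lambda>_. id_blinfun"] exI[of _ 1]) auto
  then have "G \<mu>0" using G2 D0 by (auto simp: RPhi_def)
  obtain L \<sigma> where L: "L > 0" "\<And>t \<theta>. t \<ge> 0 \<Longrightarrow> norm (scalar_cocycle_op C t \<theta>) \<le> L * exp (\<sigma> * t)"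
    using cocycle_exponential_bound[OF assms(5)] by blast
  have CL: "cmod (C t \<theta>) \<le> L * exp (\<sigma> * t)" if "t \<ge> 0" for t \<theta>
    using norm_blinfun[of "scalar_cocycle_op C t \<theta>" 1] L(2)[OF that, of \<theta>]
    by (simp add: scalar_cocycle_op_def scalar_op.rep_eq scaleC_complex_def)
  have "RC (\<sigma> + 1)"
    unfolding RC_def by (rule exI, rule dichotomy_on_above_growth[OF L]) auto
  with G1 const \<open>G \<mu>0\<close> have "?F1 (\<sigma> + 1)" by blast
  then obtain U R M where U: "dichotomy_on \<phi> (product_cocycle C \<Phi>) l U R"
    "M > 0" "\<And>\<theta> t. \<theta> \<notin> U \<Longrightarrow> t \<ge> 0 \<Longrightarrow> exp ((\<sigma> + 1) * t) \<le> M * cmod (C t \<theta>)"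
    by (auto simp: scalar_expanding_remainder_def)
  \<comment> \<open>growth at rate \<open>\<sigma> + 1\<close> outside \<open>U\<close> would contradict the growth bound of \<open>C\<close>\<close>
  have "\<theta> \<in> U" for \<theta>
  proof (rule ccontr)
    assume \<theta>: "\<theta> \<notin> U"
    obtain t :: real where t: "t \<ge> 0" "M * L < exp (1 * t)"
      using exp_eventually_large[of 1 "M * L"] by auto
    have "exp (1 * t) * exp (\<sigma> * t) = exp ((\<sigma> + 1) * t)"
      by (simp add: algebra_simps flip: exp_add)
    also have "\<dots> \<le> M * (L * exp (\<sigma> * t))"
      using U(3)[OF \<theta> t(1)] mult_left_mono[OF CL[OF t(1), of \<theta>] less_imp_le[OF U(2)]]
      by (rule order_trans)
    finally show False using t(2) by (simp flip: mult.assoc)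
  qed
  then have "U = UNIV" by blast
  with U(1) l not_in_dynamical_spectrum_iff show False by blast
qed

end
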